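(* Let $A, B \in \mathbb{C}^{n \times n}$, where $A$ is diagonalizable and $B$ has rank one. If $C = A + B$, then $|\Lambda(C)| \le 2\,|\Lambda(A)|$.
   Context: For a square complex matrix $M$, $\Lambda(M)$ denotes the set of distinct eigenvalues of $M$, and $|\Lambda(M)|$ its cardinality. Diagonalizable means diagonalizable over $\mathbb{C}$. *)

theory Defs
  imports
    "Jordan_Normal_Form.Spectral_Radius"
    "Jordan_Normal_Form.DL_Rank"
begin

definition diagonalizable_mat :: "'a :: semiring_1 mat \<Rightarrow> bool" where
  "diagonalizable_mat A \<longleftrightarrow> (\<exists>D. diagonal_mat D \<and> similar_mat A D)"

end

theory Submission
  imports Defs
begin

text \<open>
  Similarity preserves spectra and turns a rank-one perturbation into a rank-one perturbation,
  so the diagonalizable matrix may be taken to be a diagonal matrix \<open>D\<close>, perturbed by an outer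
  product \<open>U * V\<close> of a column and a row. Let \<open>z\<close> be an eigenvalue of \<open>D + U * V\<close> that is not an
  eigenvalue of \<open>D\<close>, with eigenvector \<open>y\<close>, and let \<open>s\<close> be the scalar \<open>V y\<close>. Comparing entries
  gives \<open>y\<^sub>i = U\<^sub>i s / (z - d\<^sub>i)\<close>, hence \<open>s \<noteq> 0\<close>, and substituting this back into \<open>s = V y\<close>
  yields the secular equation \<open>1 = (\<Sum>i. U\<^sub>i V\<^sub>i / (z - d\<^sub>i))\<close>
  (\<open>eigenvalue_diagonal_plus_rank_one\<close>).

  The crucial point is that the terms with equal \<open>d\<^sub>i\<close> can be merged. The secular equation then
  has at most one pole per distinct eigenvalue of \<open>D\<close>, and clearing denominators turns it into a
  polynomial equation whose degree is the number \<open>k\<close> of these eigenvalues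
  (\<open>card_secular_solutions_le\<close>). So the perturbation creates at most \<open>k\<close> new eigenvalues,
  while at most \<open>k\<close> old ones survive.
\<close>

section \<open>Rank-one matrices\<close>

text \<open>
  Two independent columns would force the rank to be at least two, so every column is a multiple
  of one nonzero column \<open>u\<close>. The factors are \<open>u\<close> and the row of the multipliers.
\<close>

lemma rank_one_imp_outer_product:
  fixes B :: "'a :: field mat"
  assumes B: "B \<in> carrier_mat n m" and rank: "vec_space.rank n B = 1"
  obtains U V where "U \<in> carrier_mat n 1" "V \<in> carrier_mat 1 m" "B = U * V"
proof -
  interpret vec_space "TYPE('a)" n .
  have cols: "set (cols B) \<subseteq> carrier_vec n"
    using B cols_dim by blast
  obtain S where S: "maximal S (\<lambda>T. T \<subseteq> set (cols B) \<and> lin_indpt T)"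
    using maximal_exists_superset[of "set (cols B)" "\<lambda>T. T \<subseteq> set (cols B) \<and> lin_indpt T" "{}"]
      finite_lin_indpt2[of "{}"] by auto
  then have "card S = 1"
    using rank_card_indpt[OF B S] rank by simp
  then obtain u where Su: "S = {u}"
    by (auto simp: card_1_singleton_iff)
  have u: "u \<in> set (cols B)" and indpt: "lin_indpt {u}"
    using S unfolding Su maximal_def by auto
  have in_span: "s \<in> span {u}" if s: "s \<in> set (cols B)" for s
  proof (rule ccontr)
    assume not: "s \<notin> span {u}"
    then have "s \<noteq> u"
      using in_own_span[of "{u}"] u cols by auto
    moreover have "lin_indpt ({u} \<union> {s})"
      using lin_dep_iff_in_span[of "{u}" s] not indpt \<open>s \<noteq> u\<close> s u cols by auto
    ultimately show False
      using rank_ge_card_indpt[OF B, of "{u} \<union> {s}"] rank s u by auto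
  qed
  have "\<exists>c. \<forall>i<n. col B j $ i = c * u $ i" if j: "j < m" for j
  proof -
    have "col B j \<in> span {u}"
      using in_span[of "col B j"] j B by (auto simp: cols_def)
    then obtain a where "col B j = lincomb a {u}"
      using finite_span[of "{u}"] u cols by auto
    then show ?thesis
      using lincomb_index[of _ "{u}" a] u cols by auto
  qed
  then obtain c where c: "\<And>i j. j < m \<Longrightarrow> i < n \<Longrightarrow> col B j $ i = c j * u $ i"
    by metis
  show thesis
  proof
    show "mat n 1 (\<lambda>(i, _). u $ i) \<in> carrier_mat n 1" "mat 1 m (\<lambda>(_, j). c j) \<in> carrier_mat 1 m"
      by auto
    show "B = mat n 1 (\<lambda>(i, _). u $ i) * mat 1 m (\<lambda>(_, j). c j)"
      using B c by (intro eq_matI) (auto simp: scalar_prod_def mult.commute)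
  qed
qed

section \<open>Spectra\<close>

lemma spectrum_similar:
  fixes A B :: "'a :: field mat"
  assumes "similar_mat A B"
  shows "spectrum A = spectrum B"
proof -
  obtain n where "A \<in> carrier_mat n n" "B \<in> carrier_mat n n"
    using similar_matD[OF assms] by auto
  then show ?thesis
    using char_poly_similar[OF assms] by (simp add: spectrum_root_char_poly)
qed

lemma diagonal_entry_in_spectrum:
  fixes D :: "'a :: field mat"
  assumes D: "D \<in> carrier_mat n n" and "diagonal_mat D" and i: "i < n"
  shows "D $$ (i, i) \<in> spectrum D"
proof -
  have "upper_triangular D"
    using assms unfolding diagonal_mat_def by auto
  then have "char_poly D = (\<Prod>a\<leftarrow>diag_mat D. [:- a, 1:])"
    using char_poly_upper_triangular[OF D] by blast
  moreover have "D $$ (i, i) \<in> set (diag_mat D)"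
    using D i by (auto simp: diag_mat_def)
  ultimately show ?thesis
    using spectrum_root_char_poly[OF D] by (auto simp: poly_prod_list prod_list_zero_iff)
qed

section \<open>The secular equation\<close>

text \<open>
  Multiplying the equation by \<open>\<Prod>a\<in>L. z - a\<close> turns its solutions into roots of a monic polynomial
  of degree \<open>card L\<close>: the sum contributes only terms of smaller degree.
\<close>

lemma card_secular_solutions_le:
  fixes w :: "'a :: field \<Rightarrow> 'a"
  assumes L: "finite L"
  shows "finite {z. z \<notin> L \<and> (\<Sum>a\<in>L. w a / (z - a)) = 1}" (is "finite ?Z")
    and "card {z. z \<notin> L \<and> (\<Sum>a\<in>L. w a / (z - a)) = 1} \<le> card L"
proof -
  define p where "p = (\<Prod>a\<in>L. [:- a, 1:])"
  define r where "r = (\<Sum>a\<in>L. Polynomial.smult (w a) (\<Prod>b\<in>L - {a}. [:- b, 1:]))"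
  have deg_prod: "degree (\<Prod>a\<in>M. [:- a, 1:]) = card M" if "finite M" for M :: "'a set"
    using that by (subst degree_prod_eq_sum_degree) auto
  have deg_p: "degree p = card L"
    unfolding p_def by (rule deg_prod[OF L])
  have coeff_r: "coeff r (card L) = 0"
    unfolding r_def coeff_sum
  proof (intro sum.neutral ballI)
    fix a assume a: "a \<in> L"
    have "degree (\<Prod>b\<in>L - {a}. [:- b, 1:]) < card L"
      using L card_Diff1_less[OF L a] by (subst deg_prod) simp_all
    then show "coeff (Polynomial.smult (w a) (\<Prod>b\<in>L - {a}. [:- b, 1:])) (card L) = 0"
      by (simp add: coeff_eq_0)
  qed
  have deg_r: "degree r \<le> card L"
    unfolding r_def using L
    by (intro degree_sum_le)
      (auto intro!: order.trans[OF degree_smult_le] simp: deg_prod card_Diff_singleton)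
  have "coeff p (card L) \<noteq> 0"
    using deg_p L leading_coeff_0_iff[of p] by (auto simp: p_def)
  then have nz: "p - r \<noteq> 0"
    using coeff_r by (metis coeff_0 coeff_diff diff_zero)
  have deg: "degree (p - r) \<le> card L"
    using degree_diff_le[of p "card L" r] deg_p deg_r by simp
  have sub: "?Z \<subseteq> {z. poly (p - r) z = 0}"
  proof safe
    fix z assume z: "z \<notin> L" and eq: "(\<Sum>a\<in>L. w a / (z - a)) = 1"
    have "poly r z = (\<Sum>a\<in>L. poly p z * (w a / (z - a)))"
      unfolding r_def p_def poly_sum
    proof (rule sum.cong)
      fix a assume a: "a \<in> L"
      then have "z - a \<noteq> 0"
        using z by auto
      moreover have "(\<Prod>b\<in>L. [:- b, 1:]) = [:- a, 1:] * (\<Prod>b\<in>L - {a}. [:- b, 1:])"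
        using L a by (rule prod.remove)
      then have "poly (\<Prod>b\<in>L. [:- b, 1:]) z = (z - a) * poly (\<Prod>b\<in>L - {a}. [:- b, 1:]) z"
        by (simp only: poly_mult) simp
      ultimately show "poly (Polynomial.smult (w a) (\<Prod>b\<in>L - {a}. [:- b, 1:])) z =
          poly (\<Prod>b\<in>L. [:- b, 1:]) z * (w a / (z - a))"
        by (simp only: poly_smult) simp
    qed simp
    also have "\<dots> = poly p z"
      by (simp only: eq sum_distrib_left[symmetric] mult_1_right)
    finally show "poly (p - r) z = 0"
      by simp
  qed
  have fin: "finite {z. poly (p - r) z = 0}"
    using nz by (rule poly_roots_finite)
  show "finite ?Z"
    using sub fin by (rule finite_subset)
  have "card ?Z \<le> card {z. poly (p - r) z = 0}"
    using fin sub by (rule card_mono)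
  also have "\<dots> \<le> degree (p - r)"
    using nz by (rule poly_roots_degree)
  finally show "card ?Z \<le> card L"
    using deg by simp
qed

lemma eigenvalue_diagonal_plus_rank_one:
  fixes D U V :: "'a :: field mat"
  assumes D: "D \<in> carrier_mat n n" and diag: "diagonal_mat D"
    and U: "U \<in> carrier_mat n 1" and V: "V \<in> carrier_mat 1 n"
    and ev: "eigenvalue (D + U * V) z" and new: "\<And>i. i < n \<Longrightarrow> z \<noteq> D $$ (i, i)"
  shows "(\<Sum>i<n. U $$ (i, 0) * V $$ (0, i) / (z - D $$ (i, i))) = 1"
proof -
  obtain y where y: "y \<in> carrier_vec n" and y0: "y \<noteq> 0\<^sub>v n"
    and eq: "(D + U * V) *\<^sub>v y = z \<cdot>\<^sub>v y"
    using ev D U V by (auto simp: eigenvalue_def eigenvector_def)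
  define s where "s = (\<Sum>i<n. V $$ (0, i) * y $ i)"
  have "z * y $ i = D $$ (i, i) * y $ i + U $$ (i, 0) * s" if i: "i < n" for i
  proof -
    have "z * y $ i = (\<Sum>j<n. (D $$ (i, j) + U $$ (i, 0) * V $$ (0, j)) * y $ j)"
      using arg_cong[OF eq, of "\<lambda>v. v $ i"] i y D U V
      by (auto simp: scalar_prod_def lessThan_atLeast0)
    also have "\<dots> = (\<Sum>j<n. D $$ (i, j) * y $ j) + U $$ (i, 0) * s"
      by (simp add: s_def sum_distrib_left sum.distrib algebra_simps)
    also have "(\<Sum>j<n. D $$ (i, j) * y $ j) = (\<Sum>j<n. if j = i then D $$ (i, i) * y $ i else 0)"
      using diag D i by (intro sum.cong) (auto simp: diagonal_mat_def)
    finally show ?thesis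
      using i by simp
  qed
  then have y_eq: "y $ i = U $$ (i, 0) * s / (z - D $$ (i, i))" if "i < n" for i
    using new[OF that] that by (simp add: field_simps)
  have "s \<noteq> 0"
    using y_eq y y0 by (auto intro!: eq_vecI)
  moreover have "s = s * (\<Sum>i<n. U $$ (i, 0) * V $$ (0, i) / (z - D $$ (i, i)))"
  proof -
    have "(\<Sum>i<n. V $$ (0, i) * y $ i) =
        (\<Sum>i<n. V $$ (0, i) * (U $$ (i, 0) * s / (z - D $$ (i, i))))"
      using y_eq by (intro sum.cong) simp_all
    also have "\<dots> = s * (\<Sum>i<n. U $$ (i, 0) * V $$ (0, i) / (z - D $$ (i, i)))"
      by (simp add: sum_distrib_left mult_ac)
    finally show ?thesis
      by (simp only: s_def[symmetric])
  qed
  ultimately show ?thesis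
    by simp
qed

section \<open>Counting eigenvalues of a rank-one perturbation\<close>

lemma card_spectrum_diagonal_plus_rank_one:
  fixes D U V :: "'a :: field mat"
  assumes D: "D \<in> carrier_mat n n" and diag: "diagonal_mat D"
    and U: "U \<in> carrier_mat n 1" and V: "V \<in> carrier_mat 1 n"
  shows "card (spectrum (D + U * V)) \<le> 2 * card (spectrum D)"
proof -
  let ?L = "spectrum D"
  let ?d = "\<lambda>i. D $$ (i, i)"
  \<comment> \<open>Merging the positions with equal diagonal entry makes the number of poles the number of
    distinct eigenvalues, instead of the dimension.\<close>
  define w where "w a = (\<Sum>i\<in>{i \<in> {..<n}. ?d i = a}. U $$ (i, 0) * V $$ (0, i))" for a
  let ?Z = "{z. z \<notin> ?L \<and> (\<Sum>a\<in>?L. w a / (z - a)) = 1}"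
  have L: "finite ?L"
    using D by (rule card_finite_spectrum)
  have d: "?d i \<in> ?L" if "i < n" for i
    using D diag that by (rule diagonal_entry_in_spectrum)
  have "spectrum (D + U * V) \<subseteq> ?L \<union> ?Z"
  proof
    fix z assume z: "z \<in> spectrum (D + U * V)"
    have "(\<Sum>a\<in>?L. w a / (z - a)) = 1" if new: "z \<notin> ?L"
    proof -
      have "(\<Sum>a\<in>?L. w a / (z - a)) =
          (\<Sum>a\<in>?L. \<Sum>i\<in>{i \<in> {..<n}. ?d i = a}. U $$ (i, 0) * V $$ (0, i) / (z - ?d i))"
        by (auto simp: w_def sum_divide_distrib intro!: sum.cong)
      also have "\<dots> = (\<Sum>i<n. U $$ (i, 0) * V $$ (0, i) / (z - ?d i))"
        using L d by (intro sum.group) auto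
      also have "\<dots> = 1"
        using D diag U V z new d
        by (intro eigenvalue_diagonal_plus_rank_one) (auto simp: spectrum_def)
      finally show ?thesis .
    qed
    then show "z \<in> ?L \<union> ?Z"
      by auto
  qed
  then have "card (spectrum (D + U * V)) \<le> card (?L \<union> ?Z)"
    using L card_secular_solutions_le(1)[OF L] by (intro card_mono) auto
  also have "\<dots> \<le> card ?L + card ?Z"
    by (rule card_Un_le)
  also have "\<dots> \<le> 2 * card ?L"
    using card_secular_solutions_le(2)[OF L, of w] by simp
  finally show ?thesis .
qed

theorem corollary1p4:
  fixes A B C :: "complex mat" and n :: nat
  assumes "A \<in> carrier_mat n n"
    and "B \<in> carrier_mat n n"
    and "diagonalizable_mat A"
    and "vec_space.rank n B = 1"
    and "C = A + B"
  shows "card (spectrum C) \<le> 2 * card (spectrum A)"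
proof -
  obtain D where diag: "diagonal_mat D" and sim: "similar_mat A D"
    using assms(3) by (auto simp: diagonalizable_mat_def)
  obtain P Q where wit: "similar_mat_wit A D P Q"
    using sim by (auto simp: similar_mat_def)
  note W = similar_mat_witD2[OF assms(1) wit]
  note D = W(5) and P = W(6) and Q = W(7)
  obtain U V where U: "U \<in> carrier_mat n 1" and V: "V \<in> carrier_mat 1 n" and B: "B = U * V"
    using rank_one_imp_outer_product[OF assms(2,4)] by blast
  have QU: "Q * U \<in> carrier_mat n 1" and VP: "V * P \<in> carrier_mat 1 n"
    using U V P Q by auto
  have "P * ((Q * U) * (V * P)) = U * (V * P)"
  proof -
    have "P * ((Q * U) * (V * P)) = (P * (Q * U)) * (V * P)"
      using P QU VP by (intro assoc_mult_mat[symmetric])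
    also have "P * (Q * U) = (P * Q) * U"
      using P Q U by (intro assoc_mult_mat[symmetric])
    finally show ?thesis
      using W(1) U by simp
  qed
  then have "P * ((Q * U) * (V * P)) * Q = U * ((V * P) * Q)"
    using U VP Q by (simp add: assoc_mult_mat[OF U VP Q])
  also have "(V * P) * Q = V"
    using W(1) V by (simp add: assoc_mult_mat[OF V P Q])
  also have "U * V = B"
    by (simp add: B)
  finally have B_eq: "P * ((Q * U) * (V * P)) * Q = B" .
  have M: "(Q * U) * (V * P) \<in> carrier_mat n n"
    using QU VP by (rule mult_carrier_mat)
  have "P * (D + (Q * U) * (V * P)) * Q = (P * D + P * ((Q * U) * (V * P))) * Q"
    by (simp only: mult_add_distrib_mat[OF P D M])
  also have "\<dots> = P * D * Q + P * ((Q * U) * (V * P)) * Q"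
    by (rule add_mult_distrib_mat[OF mult_carrier_mat[OF P D] mult_carrier_mat[OF P M] Q])
  also have "\<dots> = C"
    by (simp only: W(3) B_eq assms(5))
  finally have C_eq: "C = P * (D + (Q * U) * (V * P)) * Q" ..
  have "C \<in> carrier_mat n n" "D + (Q * U) * (V * P) \<in> carrier_mat n n"
    using assms(1,2,5) D M by auto
  then have "similar_mat C (D + (Q * U) * (V * P))"
    using P Q by (intro similar_matI[OF _ W(1,2) C_eq]) blast
  then have "spectrum C = spectrum (D + (Q * U) * (V * P))"
    by (rule spectrum_similar)
  moreover have "spectrum A = spectrum D"
    using sim by (rule spectrum_similar)
  ultimately show ?thesis
    using card_spectrum_diagonal_plus_rank_one[OF D diag QU VP] by simp
qed

end
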